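(* Let $l>0$, $c>0$, $T>\frac{2l}{c}$, $a,b\in\mathbb{R}$, $q\ge 0$, $r>0$, and set $\bar b=-\frac{b^2}{r}$. Let $p\in C^1[0,l]$ be nonnegative with $p(0)=0$, and let $\varphi\in C^1[0,l]$ with $\varphi(l)=0$. Suppose the Riccati equation $$-g_t(z,t)=q+2a\,g(z,t)+\bar b\,g^2(z,t)-c\,g_z(z,t),\qquad g(z,T)=p(z),\quad g(0,t)=0,$$ for $z\in[0,l]$, $t\in[0,T]$, has a solution $g(z,t)$; put $\bar a(z,t)=a+\bar b\,g(z,t)$, and suppose the equation $$-\tilde\psi_t(z,t)=\bar a(z,t)\tilde\psi(z,t)-c\,\tilde\psi_z(z,t),\qquad \tilde\psi(z,T)=0,\quad \tilde\psi(0,t)=0,$$ for $z\in[0,l]$, $t\in[0,T]$, has a solution $\tilde\psi(z,t)$. Consider the controller $$u^*(z,t)=-\frac{b}{r}\big[g(z,t)\tilde x^*(z,t)+\tilde\psi(z,t)\big],$$ where $\tilde x^*(z,t)$ satisfies $$\tilde x^*_t(z,t)-c\,\tilde x^*_z(z,t)=\bar a(z,t)\tilde x^*(z,t)+\bar b\,\tilde\psi(z,t),\qquad \tilde x^*(z,0)=\varphi(z),\quad \tilde x^*(l,t)=0,$$ for $z\in[0,l]$, $t\in[0,T]$. Then $u^*$ is optimal: it minimizes $$J=\frac12\int_0^T\!\!\int_0^l\big[q\,x^2(z,t)+r\,u^2(z,t)\big]dz\,dt+\frac12\int_0^l p(z)\,x^2(z,T)\,dz$$ subject to the system $$x_t(z,t)-c\,x_z(z,t)=a\,x(z,t)+b\,u(z,t),\qquad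 x(z,0)=\varphi(z),\quad x(l,t)=0,$$ with optimal state $\tilde x^*$, and under $u^*$ the system satisfies the final condition $x(z,T)=0$ for all $z\in[0,l]$. Furthermore, the corresponding optimal cost is $$J^*=\frac12\int_0^l\varphi(z)\big[g(z,0)\varphi(z)+\tilde\psi(z,0)\big]dz.$$
   Context: Subscripts $t,z$ denote partial derivatives. Solutions of the equations are understood as $C^1$ real-valued functions on $[0,l]\times[0,T]$ satisfying the equation and the stated data pointwise. Minimization is over all pairs $(u,x)$ with $u$ a continuously differentiable control on $[0,l]\times[0,T]$ and $x$ a $C^1$ solution of the system with control $u$. It is a standing assumption that the state system is well posed in the class $C^1$; in particular the closed-loop equation for $\tilde x^*$ has a unique $C^1$ solution. *)

theory Defs
  imports "HOL-Analysis.Analysis"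
begin

text \<open>Functions of the space variable z in [0,l] and the time variable t in [0,T] are represented
  as curried total functions; only their values on the closed rectangle matter.
  Partial derivatives are taken within the respective closed interval, hence they are one-sided on
  the boundary of the rectangle. For l > 0 and T > 0 they are uniquely determined.\<close>

definition partial_z :: "real \<Rightarrow> (real \<Rightarrow> real \<Rightarrow> real) \<Rightarrow> real \<Rightarrow> real \<Rightarrow> real" where
  "partial_z l f z t = vector_derivative (\<lambda>y. f y t) (at z within {0..l})"

definition partial_t :: "real \<Rightarrow> (real \<Rightarrow> real \<Rightarrow> real) \<Rightarrow> real \<Rightarrow> real \<Rightarrow> real" where
  "partial_t T f z t = vector_derivative (\<lambda>s. f z s) (at t within {0..T})"

text \<open>The library's \<open>C1_differentiable_on\<close> asks for two-sided derivatives at the end points, which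
  would constrain the functions outside [0,l].\<close>

definition C1_interval :: "real \<Rightarrow> (real \<Rightarrow> real) \<Rightarrow> bool" where
  "C1_interval l f \<longleftrightarrow>
     (\<forall>z\<in>{0..l}. f differentiable (at z within {0..l})) \<and>
     continuous_on {0..l} (\<lambda>z. vector_derivative f (at z within {0..l}))"

definition C1_rect :: "real \<Rightarrow> real \<Rightarrow> (real \<Rightarrow> real \<Rightarrow> real) \<Rightarrow> bool" where
  "C1_rect l T f \<longleftrightarrow>
     (\<forall>z\<in>{0..l}. \<forall>t\<in>{0..T}.
        (\<lambda>y. f y t) differentiable (at z within {0..l}) \<and>
        (\<lambda>s. f z s) differentiable (at t within {0..T})) \<and>
     continuous_on ({0..l} \<times> {0..T}) (\<lambda>(z, t). partial_z l f z t) \<and>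
     continuous_on ({0..l} \<times> {0..T}) (\<lambda>(z, t). partial_t T f z t)"

definition state_solution ::
  "real \<Rightarrow> real \<Rightarrow> real \<Rightarrow> real \<Rightarrow> real \<Rightarrow> (real \<Rightarrow> real) \<Rightarrow>
   (real \<Rightarrow> real \<Rightarrow> real) \<Rightarrow> (real \<Rightarrow> real \<Rightarrow> real) \<Rightarrow> bool" where
  "state_solution l T c a b \<phi> u x \<longleftrightarrow>
     C1_rect l T x \<and>
     (\<forall>z\<in>{0..l}. \<forall>t\<in>{0..T}.
        partial_t T x z t - c * partial_z l x z t = a * x z t + b * u z t) \<and>
     (\<forall>z\<in>{0..l}. x z 0 = \<phi> z) \<and>
     (\<forall>t\<in>{0..T}. x l t = 0)"

text \<open>The minimization runs over control-state pairs: a \<open>C\<^sup>1\<close> control need not admit a \<open>C\<^sup>1\<close> state,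
  because the data have to be compatible at the corner (l,0).\<close>

definition admissible_pair ::
  "real \<Rightarrow> real \<Rightarrow> real \<Rightarrow> real \<Rightarrow> real \<Rightarrow> (real \<Rightarrow> real) \<Rightarrow>
   (real \<Rightarrow> real \<Rightarrow> real) \<Rightarrow> (real \<Rightarrow> real \<Rightarrow> real) \<Rightarrow> bool" where
  "admissible_pair l T c a b \<phi> u x \<longleftrightarrow> C1_rect l T u \<and> state_solution l T c a b \<phi> u x"

definition cost ::
  "real \<Rightarrow> real \<Rightarrow> real \<Rightarrow> real \<Rightarrow> (real \<Rightarrow> real) \<Rightarrow>
   (real \<Rightarrow> real \<Rightarrow> real) \<Rightarrow> (real \<Rightarrow> real \<Rightarrow> real) \<Rightarrow> real" where
  "cost l T q r p u x =
     1 / 2 * integral {0..T} (\<lambda>t. integral {0..l} (\<lambda>z. q * (x z t)\<^sup>2 + r * (u z t)\<^sup>2)) +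
     1 / 2 * integral {0..l} (\<lambda>z. p z * (x z T)\<^sup>2)"

definition optimal_pair ::
  "real \<Rightarrow> real \<Rightarrow> real \<Rightarrow> real \<Rightarrow> real \<Rightarrow> real \<Rightarrow> real \<Rightarrow> (real \<Rightarrow> real) \<Rightarrow> (real \<Rightarrow> real) \<Rightarrow>
   (real \<Rightarrow> real \<Rightarrow> real) \<Rightarrow> (real \<Rightarrow> real \<Rightarrow> real) \<Rightarrow> bool" where
  "optimal_pair l T c a b q r p \<phi> u x \<longleftrightarrow>
     admissible_pair l T c a b \<phi> u x \<and>
     (\<forall>v y. admissible_pair l T c a b \<phi> v y \<longrightarrow> cost l T q r p u x \<le> cost l T q r p v y)"

end

theory Submission
  imports Defs
begin

text \<open>The state equation, the Riccati equation and the equation for \<open>\<psi>\<close> are transport equations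
  with the same characteristics \<open>z + c t = const\<close>. Along these, a homogeneous linear transport
  equation becomes a linear ordinary differential equation, so that a zero at one point of a
  characteristic spreads over the part of it that lies in the rectangle
  (\<open>transport_zero_propagates\<close>).

  Followed forward in time, every characteristic leaves the rectangle at \<open>z = 0\<close> or at \<open>t = T\<close>.
  The data for \<open>\<psi>\<close> vanish there, hence \<open>\<psi> = 0\<close> throughout, and the controller is the pure
  Riccati feedback \<open>- (b / r) g x\<close>.

  Optimality is a completion of the square. For every admissible pair \<open>(v, y)\<close> the Riccati
  equation gives
  \<open>(g y\<^sup>2)\<^sub>t - c (g y\<^sup>2)\<^sub>z = - (q y\<^sup>2 + r v\<^sup>2) + r (v + (b / r) g y)\<^sup>2\<close>.
  Integrated over the rectangle, the left-hand side contributes only at \<open>t = 0\<close> and \<open>t = T\<close>,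
  because \<open>g\<close> vanishes at \<open>z = 0\<close> and \<open>y\<close> vanishes at \<open>z = l\<close>. So the cost of \<open>(v, y)\<close> is the claimed
  optimal value plus a nonnegative integral (\<open>cost_completed_square\<close>), and this integral is zero
  for the feedback control.

  As \<open>T > l / c\<close>, every characteristic that arrives at \<open>t = T\<close> has entered the rectangle through
  \<open>z = l\<close>, where the state is zero. Along such a characteristic the closed-loop state vanishes, then
  so does the feedback control, and then so does every state driven by that control.\<close>

section \<open>Differentiable functions on the rectangle\<close>

lemma C1_rect_has_partials:
  assumes "C1_rect l T f" "z \<in> {0..l}" "t \<in> {0..T}"
  shows "((\<lambda>y. f y t) has_real_derivative partial_z l f z t) (at z within {0..l})"
    and "((\<lambda>s. f z s) has_real_derivative partial_t T f z t) (at t within {0..T})"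
  using assms
  by (auto simp: C1_rect_def partial_z_def partial_t_def
      has_real_derivative_iff_has_vector_derivative vector_derivative_works[symmetric])

lemma C1_rect_continuous_partials:
  assumes "C1_rect l T f"
  shows "continuous_on ({0..l} \<times> {0..T}) (\<lambda>(z, t). partial_z l f z t)"
    and "continuous_on ({0..l} \<times> {0..T}) (\<lambda>(z, t). partial_t T f z t)"
  using assms by (auto simp: C1_rect_def)

lemma partials_eqI:
  assumes "0 < l" "0 < T" "z \<in> {0..l}" "t \<in> {0..T}"
  shows "((\<lambda>y. f y t) has_real_derivative D) (at z within {0..l}) \<Longrightarrow> partial_z l f z t = D"
    and "((\<lambda>s. f z s) has_real_derivative E) (at t within {0..T}) \<Longrightarrow> partial_t T f z t = E"
  using assms
  by (auto simp: partial_z_def partial_t_def has_real_derivative_iff_has_vector_derivative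
      intro!: vector_derivative_within_closed_interval)

lemma C1_rectI:
  assumes "0 < l" "0 < T"
    and dz: "\<And>z t. z \<in> {0..l} \<Longrightarrow> t \<in> {0..T} \<Longrightarrow>
              ((\<lambda>y. f y t) has_real_derivative fz z t) (at z within {0..l})"
    and dt: "\<And>z t. z \<in> {0..l} \<Longrightarrow> t \<in> {0..T} \<Longrightarrow>
              ((\<lambda>s. f z s) has_real_derivative ft z t) (at t within {0..T})"
    and cz: "continuous_on ({0..l} \<times> {0..T}) (\<lambda>(z, t). fz z t)"
    and ct: "continuous_on ({0..l} \<times> {0..T}) (\<lambda>(z, t). ft z t)"
  shows "C1_rect l T f"
proof -
  have "continuous_on ({0..l} \<times> {0..T}) (\<lambda>(z, t). partial_z l f z t)"
    using partials_eqI(1)[OF assms(1,2) _ _ dz]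
    by (intro continuous_on_eq[OF cz]) auto
  moreover have "continuous_on ({0..l} \<times> {0..T}) (\<lambda>(z, t). partial_t T f z t)"
    using partials_eqI(2)[OF assms(1,2) _ _ dt]
    by (intro continuous_on_eq[OF ct]) auto
  ultimately show ?thesis
    using dz dt unfolding C1_rect_def
    by (meson differentiableI_vector has_real_derivative_iff_has_vector_derivative)
qed

text \<open>Continuous partial derivatives, even if they are one-sided on the boundary, give the total
  derivative. This is where the chain rule along characteristics comes from.\<close>

lemma C1_rect_has_derivative:
  assumes f: "C1_rect l T f" and "z \<in> {0..l}" "t \<in> {0..T}"
  shows "((\<lambda>(z, t). f z t) has_derivative
           (\<lambda>(h, k). h * partial_z l f z t + k * partial_t T f z t))
         (at (z, t) within {0..l} \<times> {0..T})"
proof -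
  let ?fy = "\<lambda>z t. blinfun_mult_left (partial_t T f z t)"
  have "continuous_on ({0..l} \<times> {0..T}) (\<lambda>(z, t). ?fy z t)"
    using C1_rect_continuous_partials(2)[OF f]
    by (auto simp: case_prod_unfold intro!: continuous_intros bounded_linear.continuous_on[OF bounded_linear_blinfun_mult_left])
  then have "continuous (at (z, t) within {0..l} \<times> {0..T}) (\<lambda>(z, t). ?fy z t)"
    using assms by (auto simp: continuous_on_eq_continuous_within)
  then have "((\<lambda>(z, t). f z t) has_derivative (\<lambda>(h, k). partial_z l f z t * h + ?fy z t k))
        (at (z, t) within {0..l} \<times> {0..T})"
    using C1_rect_has_partials[OF f] assms
    by (intro has_derivative_partialsI) (auto simp: has_field_derivative_def mult_commute_abs)
  then show ?thesis
    by (simp add: mult.commute)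
qed

lemma C1_rect_continuous:
  assumes "C1_rect l T f"
  shows "continuous_on ({0..l} \<times> {0..T}) (\<lambda>(z, t). f z t)"
  unfolding continuous_on_eq_continuous_within
  using has_derivative_continuous[OF C1_rect_has_derivative[OF assms]] by auto

lemma C1_rect_deriv_along_line:
  assumes f: "C1_rect l T f"
    and line: "\<And>s. s \<in> S \<Longrightarrow> z\<^sub>0 + v * s \<in> {0..l} \<and> t\<^sub>0 + w * s \<in> {0..T}"
    and s: "s \<in> S"
  shows "((\<lambda>s. f (z\<^sub>0 + v * s) (t\<^sub>0 + w * s)) has_real_derivative
           v * partial_z l f (z\<^sub>0 + v * s) (t\<^sub>0 + w * s) + w * partial_t T f (z\<^sub>0 + v * s) (t\<^sub>0 + w * s))
         (at s within S)"
proof -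
  let ?\<gamma> = "\<lambda>s. (z\<^sub>0 + v * s, t\<^sub>0 + w * s)"
  have \<gamma>: "(?\<gamma> has_derivative (\<lambda>h. (v * h, w * h))) (at s within S)"
    by (auto intro!: derivative_eq_intros)
  have "((\<lambda>(z, t). f z t) has_derivative
           (\<lambda>(h, k). h * partial_z l f (z\<^sub>0 + v * s) (t\<^sub>0 + w * s)
                   + k * partial_t T f (z\<^sub>0 + v * s) (t\<^sub>0 + w * s)))
        (at (?\<gamma> s) within ?\<gamma> ` S)"
    by (rule has_derivative_subset[OF C1_rect_has_derivative[OF f]]) (use line s in auto)
  from diff_chain_within[OF \<gamma> this]
  have "((\<lambda>s. f (z\<^sub>0 + v * s) (t\<^sub>0 + w * s)) has_derivative
           (\<lambda>h. v * h * partial_z l f (z\<^sub>0 + v * s) (t\<^sub>0 + w * s)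
              + w * h * partial_t T f (z\<^sub>0 + v * s) (t\<^sub>0 + w * s))) (at s within S)"
    by (simp add: o_def)
  then show ?thesis
    unfolding has_field_derivative_def
    by (rule has_derivative_eq_rhs) (simp add: fun_eq_iff algebra_simps)
qed

lemma C1_rect_mult:
  assumes "0 < l" "0 < T" and f: "C1_rect l T f" and g: "C1_rect l T g"
  shows "C1_rect l T (\<lambda>z t. f z t * g z t)"
    and "z \<in> {0..l} \<Longrightarrow> t \<in> {0..T} \<Longrightarrow>
      partial_z l (\<lambda>z t. f z t * g z t) z t = partial_z l f z t * g z t + partial_z l g z t * f z t"
    and "z \<in> {0..l} \<Longrightarrow> t \<in> {0..T} \<Longrightarrow>
      partial_t T (\<lambda>z t. f z t * g z t) z t = partial_t T f z t * g z t + partial_t T g z t * f z t"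
proof -
  note D = DERIV_mult[OF C1_rect_has_partials(1)[OF f] C1_rect_has_partials(1)[OF g]]
    DERIV_mult[OF C1_rect_has_partials(2)[OF f] C1_rect_has_partials(2)[OF g]]
  note C = C1_rect_continuous[OF f] C1_rect_continuous[OF g]
    C1_rect_continuous_partials[OF f] C1_rect_continuous_partials[OF g]
  show "C1_rect l T (\<lambda>z t. f z t * g z t)"
    using C by (intro C1_rectI[OF assms(1,2) D]) (auto simp: case_prod_unfold intro!: continuous_intros)
  show "z \<in> {0..l} \<Longrightarrow> t \<in> {0..T} \<Longrightarrow>
      partial_z l (\<lambda>z t. f z t * g z t) z t = partial_z l f z t * g z t + partial_z l g z t * f z t"
    and "z \<in> {0..l} \<Longrightarrow> t \<in> {0..T} \<Longrightarrow>
      partial_t T (\<lambda>z t. f z t * g z t) z t = partial_t T f z t * g z t + partial_t T g z t * f z t"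
    by (rule partials_eqI(1)[OF assms(1,2) _ _ D(1)] partials_eqI(2)[OF assms(1,2) _ _ D(2)]; assumption)+
qed

lemma C1_rect_add:
  assumes "0 < l" "0 < T" and f: "C1_rect l T f" and g: "C1_rect l T g"
  shows "C1_rect l T (\<lambda>z t. f z t + g z t)"
  using C1_rect_continuous_partials[OF f] C1_rect_continuous_partials[OF g]
  by (intro C1_rectI[OF assms(1,2)
        DERIV_add[OF C1_rect_has_partials(1)[OF f] C1_rect_has_partials(1)[OF g]]
        DERIV_add[OF C1_rect_has_partials(2)[OF f] C1_rect_has_partials(2)[OF g]]])
     (auto simp: case_prod_unfold intro!: continuous_intros)

lemma C1_rect_const:
  assumes "0 < l" "0 < T"
  shows "C1_rect l T (\<lambda>z t. k)"
  by (rule C1_rectI[OF assms, where fz = "\<lambda>_ _. 0" and ft = "\<lambda>_ _. 0"]) (auto simp: case_prod_unfold)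

section \<open>Homogeneous transport along characteristics\<close>

text \<open>Uniqueness in Gronwall form: \<open>w\<^sup>2\<close> grows at most at the exponential rate \<open>2 M\<close>, hence
  \<open>w\<^sup>2 e\<^bsup>- 2 M s\<^esup>\<close> is nonincreasing, nonnegative, and zero at the start.\<close>

lemma zero_if_deriv_bounded_by_self:
  fixes w w' :: "real \<Rightarrow> real"
  assumes "S \<ge> 0"
    and w: "\<And>s. s \<in> {0..S} \<Longrightarrow> (w has_real_derivative w' s) (at s within {0..S})"
    and bound: "\<And>s. s \<in> {0..S} \<Longrightarrow> \<bar>w' s\<bar> \<le> M * \<bar>w s\<bar>"
    and "w 0 = 0"
  shows "w S = 0"
proof -
  define v where "v s = (w s)\<^sup>2 * exp (- 2 * M * s)" for s
  define v' where "v' s = 2 * (w s * w' s - M * (w s)\<^sup>2) * exp (- 2 * M * s)" for s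
  have v: "(v has_real_derivative v' s) (at s within {0..S})" if "s \<in> {0..S}" for s
    unfolding v_def v'_def
    by (auto intro!: derivative_eq_intros w[OF that] simp: algebra_simps power2_eq_square)
  have "v' s \<le> 0" if "s \<in> {0..S}" for s
  proof -
    have "w s * w' s \<le> \<bar>w s\<bar> * \<bar>w' s\<bar>"
      by (metis abs_ge_self abs_mult)
    also have "\<dots> \<le> \<bar>w s\<bar> * (M * \<bar>w s\<bar>)"
      by (intro mult_left_mono bound that) auto
    also have "\<dots> = M * (w s)\<^sup>2"
      by (simp add: power2_eq_square)
    finally show ?thesis
      by (simp add: v'_def mult_nonpos_nonneg)
  qed
  moreover have "continuous_on {0..S} v"
    using v DERIV_continuous_on by blast
  moreover have "(v has_real_derivative v' s) (at s)" if "0 < s" "s < S" for s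
    using v[of s] that by (simp add: at_within_Icc_at)
  ultimately have "v S \<le> v 0"
    by (intro DERIV_nonpos_imp_decreasing_open[OF \<open>S \<ge> 0\<close>] exI[of _ "v' _"] conjI) auto
  then have "(w S)\<^sup>2 * exp (- 2 * M * S) \<le> 0"
    by (simp add: v_def \<open>w 0 = 0\<close>)
  then show ?thesis
    by (simp add: mult_le_0_iff)
qed

text \<open>The point \<open>(z\<^sub>1, t\<^sub>1)\<close> may lie before or after \<open>(z\<^sub>0, t\<^sub>0)\<close>, so the lemma covers data prescribed
  at the outflow as well as at the inflow boundary. The equation is assumed only on the
  characteristic itself, where a source term may vanish although it does not vanish elsewhere.\<close>

lemma transport_zero_propagates:
  assumes w: "C1_rect l T w"
    and \<alpha>: "continuous_on ({0..l} \<times> {0..T}) (\<lambda>(z, t). \<alpha> z t)"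
    and eq: "\<And>z t. z \<in> {0..l} \<Longrightarrow> t \<in> {0..T} \<Longrightarrow> z + c * t = z\<^sub>0 + c * t\<^sub>0 \<Longrightarrow>
               partial_t T w z t - c * partial_z l w z t = \<alpha> z t * w z t"
    and pts: "z\<^sub>0 \<in> {0..l}" "t\<^sub>0 \<in> {0..T}" "z\<^sub>1 \<in> {0..l}" "t\<^sub>1 \<in> {0..T}"
    and char: "z\<^sub>1 + c * t\<^sub>1 = z\<^sub>0 + c * t\<^sub>0"
    and zero: "w z\<^sub>0 t\<^sub>0 = 0"
  shows "w z\<^sub>1 t\<^sub>1 = 0"
proof -
  let ?z = "\<lambda>s. z\<^sub>0 + (z\<^sub>1 - z\<^sub>0) * s" and ?t = "\<lambda>s. t\<^sub>0 + (t\<^sub>1 - t\<^sub>0) * s"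
  have seg: "x + (y - x) * s \<in> {0..m}"
    if "x \<in> {0..m}" "y \<in> {0..m}" "s \<in> {0..1}" for x y s m :: real
  proof -
    have "x + (y - x) * s = (1 - s) *\<^sub>R x + s *\<^sub>R y"
      by (simp add: algebra_simps)
    then show ?thesis
      using that convexD_alt[OF convex_real_interval(5), of x 0 m y s] by auto
  qed
  have line: "?z s \<in> {0..l} \<and> ?t s \<in> {0..T}" if "s \<in> {0..1}" for s
    using seg pts that by blast
  have slope: "z\<^sub>1 - z\<^sub>0 = - c * (t\<^sub>1 - t\<^sub>0)"
    using char by (simp add: algebra_simps)
  have slope_combine: "(z\<^sub>1 - z\<^sub>0) * X + (t\<^sub>1 - t\<^sub>0) * Y = (t\<^sub>1 - t\<^sub>0) * (Y - c * X)" for X Y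
    unfolding slope by (simp add: algebra_simps)
  have "compact ((\<lambda>(z, t). \<alpha> z t) ` ({0..l} \<times> {0..T}))"
    by (intro compact_continuous_image[OF \<alpha>] compact_Times) auto
  then obtain K where K: "\<And>z t. z \<in> {0..l} \<Longrightarrow> t \<in> {0..T} \<Longrightarrow> \<bar>\<alpha> z t\<bar> \<le> K"
    by (force dest!: compact_imp_bounded simp: bounded_iff)
  have "w (?z 1) (?t 1) = 0"
  proof (rule zero_if_deriv_bounded_by_self[where w = "\<lambda>s. w (?z s) (?t s)"])
    fix s :: real assume s: "s \<in> {0..1}"
    show "((\<lambda>s. w (?z s) (?t s)) has_real_derivative
        (z\<^sub>1 - z\<^sub>0) * partial_z l w (?z s) (?t s) + (t\<^sub>1 - t\<^sub>0) * partial_t T w (?z s) (?t s))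
        (at s within {0..1})"
      by (rule C1_rect_deriv_along_line[OF w line s])
    have "?z s + c * ?t s = z\<^sub>0 + c * t\<^sub>0"
      unfolding slope by (simp add: algebra_simps)
    then have "partial_t T w (?z s) (?t s) - c * partial_z l w (?z s) (?t s)
        = \<alpha> (?z s) (?t s) * w (?z s) (?t s)"
      using line[OF s] by (intro eq) auto
    then have "(z\<^sub>1 - z\<^sub>0) * partial_z l w (?z s) (?t s) + (t\<^sub>1 - t\<^sub>0) * partial_t T w (?z s) (?t s)
        = (t\<^sub>1 - t\<^sub>0) * (\<alpha> (?z s) (?t s) * w (?z s) (?t s))"
      using slope_combine[of "partial_z l w (?z s) (?t s)" "partial_t T w (?z s) (?t s)"] by simp
    moreover have "\<bar>\<alpha> (?z s) (?t s)\<bar> \<le> K"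
      using K line[OF s] by blast
    ultimately show "\<bar>(z\<^sub>1 - z\<^sub>0) * partial_z l w (?z s) (?t s) + (t\<^sub>1 - t\<^sub>0) * partial_t T w (?z s) (?t s)\<bar>
        \<le> (\<bar>t\<^sub>1 - t\<^sub>0\<bar> * K) * \<bar>w (?z s) (?t s)\<bar>"
      by (simp add: abs_mult mult.assoc mult_left_mono mult_right_mono)
  qed (use zero in auto)
  then show ?thesis
    by simp
qed

text \<open>Every characteristic leaves the rectangle through \<open>z = 0\<close> or \<open>t = T\<close>; the case distinction
  tells which side it meets.\<close>

lemma transport_zero_if_zero_at_outflow:
  assumes "c > 0"
    and w: "C1_rect l T w"
    and \<alpha>: "continuous_on ({0..l} \<times> {0..T}) (\<lambda>(z, t). \<alpha> z t)"
    and eq: "\<And>z t. z \<in> {0..l} \<Longrightarrow> t \<in> {0..T} \<Longrightarrow>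
               partial_t T w z t - c * partial_z l w z t = \<alpha> z t * w z t"
    and final: "\<And>z. z \<in> {0..l} \<Longrightarrow> w z T = 0"
    and left: "\<And>t. t \<in> {0..T} \<Longrightarrow> w 0 t = 0"
    and z: "z \<in> {0..l}" and t: "t \<in> {0..T}"
  shows "w z t = 0"
proof (cases "z + c * t \<le> c * T")
  case True
  have exit: "t + z / c \<in> {0..T}"
    using True z t \<open>c > 0\<close> by (auto simp: field_simps)
  have "0 \<in> {0..l}" and "z + c * t = 0 + c * (t + z / c)"
    using z \<open>c > 0\<close> by (auto simp: field_simps)
  then show ?thesis
    using transport_zero_propagates[OF w \<alpha> eq _ exit z t _ left[OF exit]] by blast
next
  case False
  have "c * t \<le> c * T"
    using t \<open>c > 0\<close> by auto
  with False z have exit: "z + c * t - c * T \<in> {0..l}"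
    by auto
  have "T \<in> {0..T}" and "z + c * t = (z + c * t - c * T) + c * T"
    using t by auto
  then show ?thesis
    using transport_zero_propagates[OF w \<alpha> eq exit _ z t _ final[OF exit]] by blast
qed

section \<open>Completing the square\<close>

lemma integral_transport:
  assumes "0 < l" "0 < T" and F: "C1_rect l T F"
    and bdry: "\<And>t. t \<in> {0..T} \<Longrightarrow> F 0 t = 0 \<and> F l t = 0"
  shows "integral {0..T} (\<lambda>t. integral {0..l} (\<lambda>z. partial_t T F z t - c * partial_z l F z t))
       = integral {0..l} (\<lambda>z. F z T) - integral {0..l} (\<lambda>z. F z 0)"
proof -
  note cont = C1_rect_continuous_partials[OF F]
  have slice_z: "(\<lambda>z. h z t) integrable_on {0..l}"
    if "continuous_on ({0..l} \<times> {0..T}) (\<lambda>(z, t). h z t)" "t \<in> {0..T}" for h :: "real \<Rightarrow> real \<Rightarrow> real" and t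
    using that by (intro integrable_continuous_interval
        continuous_on_compose2[OF that(1), of _ "\<lambda>z. (z, t)", simplified]) (auto intro!: continuous_intros)
  have "integral {0..T} (\<lambda>t. integral {0..l} (\<lambda>z. partial_t T F z t - c * partial_z l F z t))
      = integral {0..T} (\<lambda>t. integral {0..l} (\<lambda>z. partial_t T F z t))"
  proof (rule integral_cong)
    fix t assume t: "t \<in> {0..T}"
    have "((\<lambda>z. partial_z l F z t) has_integral F l t - F 0 t) {0..l}"
      using C1_rect_has_partials(1)[OF F] t \<open>0 < l\<close>
      by (intro fundamental_theorem_of_calculus)
         (auto simp flip: has_real_derivative_iff_has_vector_derivative)
    then have "integral {0..l} (\<lambda>z. partial_z l F z t) = 0"
      using bdry[OF t] by (simp add: integral_unique)
    then show "integral {0..l} (\<lambda>z. partial_t T F z t - c * partial_z l F z t)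
        = integral {0..l} (\<lambda>z. partial_t T F z t)"
      using integral_diff[OF slice_z[OF cont(2) t] integrable_on_cmult_left[OF slice_z[OF cont(1) t], of c]]
      by simp
  qed
  also have "\<dots> = integral {0..l} (\<lambda>z. integral {0..T} (\<lambda>t. partial_t T F z t))"
    using integral_swap_continuous[of 0 0 l T "partial_t T F"] cont(2)
    by (simp flip: cbox_Pair_eq add: cbox_Pair_eq)
  also have "\<dots> = integral {0..l} (\<lambda>z. F z T - F z 0)"
  proof (rule integral_cong)
    fix z assume z: "z \<in> {0..l}"
    have "((\<lambda>t. partial_t T F z t) has_integral F z T - F z 0) {0..T}"
      using C1_rect_has_partials(2)[OF F] z \<open>0 < T\<close>
      by (intro fundamental_theorem_of_calculus)
         (auto simp flip: has_real_derivative_iff_has_vector_derivative)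
    then show "integral {0..T} (\<lambda>t. partial_t T F z t) = F z T - F z 0"
      by (rule integral_unique)
  qed
  also have "\<dots> = integral {0..l} (\<lambda>z. F z T) - integral {0..l} (\<lambda>z. F z 0)"
    using slice_z[OF C1_rect_continuous[OF F]] \<open>0 < T\<close> by (intro integral_diff) auto
  finally show ?thesis .
qed

lemma double_integral_diff:
  fixes f g :: "real \<Rightarrow> real \<Rightarrow> real"
  assumes "continuous_on ({0..l} \<times> {0..T}) (\<lambda>(z, t). f z t)"
    and "continuous_on ({0..l} \<times> {0..T}) (\<lambda>(z, t). g z t)"
  shows "integral {0..T} (\<lambda>t. integral {0..l} (\<lambda>z. f z t - g z t))
       = integral {0..T} (\<lambda>t. integral {0..l} (\<lambda>z. f z t)) - integral {0..T} (\<lambda>t. integral {0..l} (\<lambda>z. g z t))"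
proof -
  have inner: "(\<lambda>z. h z t) integrable_on {0..l}"
    and outer: "(\<lambda>t. integral {0..l} (\<lambda>z. h z t)) integrable_on {0..T}"
    if h: "continuous_on ({0..l} \<times> {0..T}) (\<lambda>(z, t). h z t)" and "t \<in> {0..T}"
    for h :: "real \<Rightarrow> real \<Rightarrow> real" and t
  proof -
    show "(\<lambda>z. h z t) integrable_on {0..l}"
      using that(2) by (intro integrable_continuous_interval
          continuous_on_compose2[OF h, of _ "\<lambda>z. (z, t)", simplified]) (auto intro!: continuous_intros)
    have "continuous_on ({0..T} \<times> cbox 0 l) (\<lambda>x. (\<lambda>(z, t). h z t) (snd x, fst x))"
      by (rule continuous_on_compose2[OF h]) (auto intro!: continuous_intros)
    then have "continuous_on ({0..T} \<times> cbox 0 l) (\<lambda>(t, z). h z t)"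
      by (simp add: case_prod_unfold)
    from integral_continuous_on_param[OF this]
    show "(\<lambda>t. integral {0..l} (\<lambda>z. h z t)) integrable_on {0..T}"
      by (intro integrable_continuous_interval) simp
  qed
  have "integral {0..T} (\<lambda>t. integral {0..l} (\<lambda>z. f z t - g z t))
      = integral {0..T} (\<lambda>t. integral {0..l} (\<lambda>z. f z t) - integral {0..l} (\<lambda>z. g z t))"
    by (intro integral_cong integral_diff inner assms)
  also have "\<dots> = integral {0..T} (\<lambda>t. integral {0..l} (\<lambda>z. f z t)) - integral {0..T} (\<lambda>t. integral {0..l} (\<lambda>z. g z t))"
  proof (cases "0 \<le> T")
    case True
    then show ?thesis
      using outer[OF assms(1), of 0] outer[OF assms(2), of 0] by (intro integral_diff) auto
  qed simp
  finally show ?thesis .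
qed

text \<open>A function that is not integrable has integral \<open>0\<close>.\<close>

lemma integral_nonneg_even_if_not_integrable:
  fixes f :: "'a::euclidean_space \<Rightarrow> real"
  assumes "\<And>x. x \<in> S \<Longrightarrow> 0 \<le> f x"
  shows "0 \<le> integral S f"
  using assms by (metis Henstock_Kurzweil_Integration.integral_nonneg not_integrable_integral order_refl)

text \<open>With \<open>F = g y\<^sup>2\<close>, the Riccati equation is exactly what makes \<open>F\<^sub>t - c F\<^sub>z\<close> equal to
  \<open>r\<close> times a square minus the integrand of the running cost. At \<open>t = T\<close>, \<open>F\<close> is the integrand of the
  terminal cost.\<close>

lemma cost_completed_square:
  fixes g v y :: "real \<Rightarrow> real \<Rightarrow> real"
  assumes "0 < l" "0 < T" "r \<noteq> 0"
    and g: "C1_rect l T g"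
    and riccati: "\<And>z t. z \<in> {0..l} \<Longrightarrow> t \<in> {0..T} \<Longrightarrow>
           - partial_t T g z t = q + 2 * a * g z t - b\<^sup>2 / r * (g z t)\<^sup>2 - c * partial_z l g z t"
    and final: "\<And>z. z \<in> {0..l} \<Longrightarrow> g z T = p z"
    and left: "\<And>t. t \<in> {0..T} \<Longrightarrow> g 0 t = 0"
    and vy: "admissible_pair l T c a b \<phi> v y"
  shows "cost l T q r p v y = 1 / 2 * integral {0..l} (\<lambda>z. g z 0 * (\<phi> z)\<^sup>2)
       + 1 / 2 * integral {0..T} (\<lambda>t. integral {0..l} (\<lambda>z. r * (v z t + b / r * g z t * y z t)\<^sup>2))"
proof -
  have v: "C1_rect l T v" and y: "C1_rect l T y"
    and state: "\<And>z t. z \<in> {0..l} \<Longrightarrow> t \<in> {0..T} \<Longrightarrow>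
        partial_t T y z t - c * partial_z l y z t = a * y z t + b * v z t"
    and y0: "\<And>z. z \<in> {0..l} \<Longrightarrow> y z 0 = \<phi> z" and yl: "\<And>t. t \<in> {0..T} \<Longrightarrow> y l t = 0"
    using vy by (auto simp: admissible_pair_def state_solution_def)
  let ?F = "\<lambda>z t. g z t * (y z t * y z t)"
  let ?L = "\<lambda>z t. q * (y z t)\<^sup>2 + r * (v z t)\<^sup>2"
  let ?Q = "\<lambda>z t. r * (v z t + b / r * g z t * y z t)\<^sup>2"
  note yy = C1_rect_mult[OF assms(1,2) y y]
  note F = C1_rect_mult[OF assms(1,2) g yy(1)]
  have square: "partial_t T ?F z t - c * partial_z l ?F z t = ?Q z t - ?L z t"
    if zt: "z \<in> {0..l}" "t \<in> {0..T}" for z t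
  proof -
    have y_t: "partial_t T y z t = c * partial_z l y z t + a * y z t + b * v z t"
      using state[OF zt] by simp
    have g_t: "partial_t T g z t
        = c * partial_z l g z t - q - 2 * a * g z t + b\<^sup>2 / r * (g z t)\<^sup>2"
      using riccati[OF zt] by simp
    show ?thesis
      unfolding F(2,3)[OF zt] yy(2,3)[OF zt] y_t g_t
      using \<open>r \<noteq> 0\<close> by (simp add: field_simps power2_eq_square)
  qed
  note C = C1_rect_continuous[OF g] C1_rect_continuous[OF v] C1_rect_continuous[OF y]
  have "integral {0..l} (\<lambda>z. ?F z T) - integral {0..l} (\<lambda>z. ?F z 0)
      = integral {0..T} (\<lambda>t. integral {0..l} (\<lambda>z. partial_t T ?F z t - c * partial_z l ?F z t))"
    by (rule integral_transport[OF assms(1,2) F(1), symmetric]) (simp add: left yl)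
  also have "\<dots> = integral {0..T} (\<lambda>t. integral {0..l} (\<lambda>z. ?Q z t - ?L z t))"
    by (intro integral_cong square)
  also have "\<dots> = integral {0..T} (\<lambda>t. integral {0..l} (\<lambda>z. ?Q z t))
      - integral {0..T} (\<lambda>t. integral {0..l} (\<lambda>z. ?L z t))"
    using C \<open>r \<noteq> 0\<close> by (intro double_integral_diff) (auto simp: case_prod_unfold intro!: continuous_intros)
  finally have balance: "integral {0..l} (\<lambda>z. ?F z T) - integral {0..l} (\<lambda>z. ?F z 0)
      = integral {0..T} (\<lambda>t. integral {0..l} (\<lambda>z. ?Q z t))
      - integral {0..T} (\<lambda>t. integral {0..l} (\<lambda>z. ?L z t))" .
  have "integral {0..l} (\<lambda>z. ?F z T) = integral {0..l} (\<lambda>z. p z * (y z T)\<^sup>2)"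
    and "integral {0..l} (\<lambda>z. ?F z 0) = integral {0..l} (\<lambda>z. g z 0 * (\<phi> z)\<^sup>2)"
    by (rule integral_cong, simp only: final y0 power2_eq_square)+
  with balance show ?thesis
    unfolding cost_def by linarith
qed

section \<open>Optimality of the feedback control\<close>

theorem corollary1:
  fixes l c T a b q r bbar :: real
    and p \<phi> :: "real \<Rightarrow> real"
    and g abar \<psi> xs us :: "real \<Rightarrow> real \<Rightarrow> real"
  assumes "l > 0" and "c > 0" and "T > 2 * l / c" and "q \<ge> 0" and "r > 0"
    and bbar: "bbar = - (b\<^sup>2 / r)"
    and "C1_interval l p" and "\<forall>z\<in>{0..l}. p z \<ge> 0" and "p 0 = 0"
    and "C1_interval l \<phi>" and "\<phi> l = 0"
    and "C1_rect l T g"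
    and "\<forall>z\<in>{0..l}. \<forall>t\<in>{0..T}.
           - partial_t T g z t = q + 2 * a * g z t + bbar * (g z t)\<^sup>2 - c * partial_z l g z t"
    and "\<forall>z\<in>{0..l}. g z T = p z" and "\<forall>t\<in>{0..T}. g 0 t = 0"
    and abar: "abar = (\<lambda>z t. a + bbar * g z t)"
    and "C1_rect l T \<psi>"
    and "\<forall>z\<in>{0..l}. \<forall>t\<in>{0..T}.
           - partial_t T \<psi> z t = abar z t * \<psi> z t - c * partial_z l \<psi> z t"
    and "\<forall>z\<in>{0..l}. \<psi> z T = 0" and "\<forall>t\<in>{0..T}. \<psi> 0 t = 0"
    and "C1_rect l T xs"
    and "\<forall>z\<in>{0..l}. \<forall>t\<in>{0..T}.
           partial_t T xs z t - c * partial_z l xs z t = abar z t * xs z t + bbar * \<psi> z t"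
    and "\<forall>z\<in>{0..l}. xs z 0 = \<phi> z" and "\<forall>t\<in>{0..T}. xs l t = 0"
    and us: "us = (\<lambda>z t. - (b / r) * (g z t * xs z t + \<psi> z t))"
  shows "optimal_pair l T c a b q r p \<phi> us xs
    \<and> (\<forall>x. state_solution l T c a b \<phi> us x \<longrightarrow> (\<forall>z\<in>{0..l}. x z T = 0))
    \<and> cost l T q r p us xs = 1 / 2 * integral {0..l} (\<lambda>z. \<phi> z * (g z 0 * \<phi> z + \<psi> z 0))"
proof -
  have "0 < 2 * l / c"
    using \<open>l > 0\<close> \<open>c > 0\<close> by simp
  with \<open>T > 2 * l / c\<close> have "0 < T"
    by linarith
  have "l / c < T"
    using \<open>0 < 2 * l / c\<close> \<open>T > 2 * l / c\<close> by simp
  note pos = \<open>0 < l\<close> \<open>0 < T\<close>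
  note xs = \<open>C1_rect l T xs\<close> and g = \<open>C1_rect l T g\<close> and \<psi> = \<open>C1_rect l T \<psi>\<close>
  have abar_cont: "continuous_on ({0..l} \<times> {0..T}) (\<lambda>(z, t). abar z t)"
    using C1_rect_continuous[OF g]
    by (auto simp: abar case_prod_unfold intro!: continuous_intros)
  have \<psi>0: "\<psi> z t = 0" if "z \<in> {0..l}" "t \<in> {0..T}" for z t
  proof (rule transport_zero_if_zero_at_outflow[OF \<open>c > 0\<close> \<psi>])
    show "continuous_on ({0..l} \<times> {0..T}) (\<lambda>(z, t). - abar z t)"
      using continuous_on_minus[OF abar_cont] by (simp add: case_prod_unfold)
    show "partial_t T \<psi> z t - c * partial_z l \<psi> z t = - abar z t * \<psi> z t"
      if "z \<in> {0..l}" "t \<in> {0..T}" for z t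
      using bspec[OF bspec[OF assms(18) that(1)] that(2)] by linarith
  qed (use that assms(19,20) in blast)+
  have "C1_rect l T us"
    unfolding us by (intro C1_rect_mult(1) C1_rect_add C1_rect_const pos g xs \<psi>)
  moreover have "state_solution l T c a b \<phi> us xs"
    unfolding state_solution_def
    using xs assms(22-24) by (auto simp: abar us bbar power2_eq_square algebra_simps)
  ultimately have adm: "admissible_pair l T c a b \<phi> us xs"
    by (simp add: admissible_pair_def)
  have "r \<noteq> 0"
    using \<open>r > 0\<close> by simp
  have riccati: "- partial_t T g z t = q + 2 * a * g z t - b\<^sup>2 / r * (g z t)\<^sup>2 - c * partial_z l g z t"
    if "z \<in> {0..l}" "t \<in> {0..T}" for z t
    using that assms(13) by (simp add: bbar)
  let ?J = "1 / 2 * integral {0..l} (\<lambda>z. g z 0 * (\<phi> z)\<^sup>2)"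
  have square: "cost l T q r p v y = ?J
      + 1 / 2 * integral {0..T} (\<lambda>t. integral {0..l} (\<lambda>z. r * (v z t + b / r * g z t * y z t)\<^sup>2))"
    if "admissible_pair l T c a b \<phi> v y" for v y
    by (rule cost_completed_square[OF pos \<open>r \<noteq> 0\<close> g _ _ _ that])
       (use riccati assms(14,15) in blast)+
  have "integral {0..T} (\<lambda>t. integral {0..l} (\<lambda>z. r * (us z t + b / r * g z t * xs z t)\<^sup>2))
      = integral {0..T} (\<lambda>t. integral {0..l} (\<lambda>z. 0))"
    by (intro integral_cong) (simp add: us \<psi>0 algebra_simps)
  then have cost_us: "cost l T q r p us xs = ?J"
    using square[OF adm] by simp
  have lower: "?J \<le> cost l T q r p v y" if "admissible_pair l T c a b \<phi> v y" for v y
  proof -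
    have "0 \<le> integral {0..T} (\<lambda>t. integral {0..l} (\<lambda>z. r * (v z t + b / r * g z t * y z t)\<^sup>2))"
      using \<open>r > 0\<close> by (intro integral_nonneg_even_if_not_integrable) simp
    then show ?thesis
      using square[OF that] by simp
  qed
  have final: "x z T = 0" if x: "state_solution l T c a b \<phi> us x" and z: "z \<in> {0..l}" for x z
  proof -
    \<comment> \<open>The characteristic through \<open>(z, T)\<close> enters the rectangle at \<open>(l, t\<^sub>0)\<close>.\<close>
    define t\<^sub>0 where "t\<^sub>0 = T - (l - z) / c"
    have "(l - z) / c \<le> l / c" "0 \<le> (l - z) / c"
      using z \<open>c > 0\<close> by (auto simp: divide_right_mono)
    then have t\<^sub>0: "t\<^sub>0 \<in> {0..T}"
      using \<open>l / c < T\<close> by (simp add: t\<^sub>0_def)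
    have l: "l \<in> {0..l}"
      using \<open>l > 0\<close> by simp
    have entry: "z + c * T = l + c * t\<^sub>0"
      using \<open>c > 0\<close> by (simp add: t\<^sub>0_def field_simps)
    have xs_zero: "xs y s = 0" if "y \<in> {0..l}" "s \<in> {0..T}" "y + c * s = l + c * t\<^sub>0" for y s
    proof (rule transport_zero_propagates[OF xs abar_cont _ l t\<^sub>0 that])
      show "partial_t T xs y s - c * partial_z l xs y s = abar y s * xs y s"
        if "y \<in> {0..l}" "s \<in> {0..T}" for y s
        using bspec[OF bspec[OF assms(22) that(1)] that(2)] \<psi>0[OF that] by simp
      show "xs l t\<^sub>0 = 0"
        using assms(24) t\<^sub>0 by blast
    qed
    have "C1_rect l T x" and xl: "x l t\<^sub>0 = 0"
      and eq: "\<And>y s. y \<in> {0..l} \<Longrightarrow> s \<in> {0..T} \<Longrightarrow>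
        partial_t T x y s - c * partial_z l x y s = a * x y s + b * us y s"
      using x t\<^sub>0 by (auto simp: state_solution_def)
    show ?thesis
    proof (rule transport_zero_propagates[OF \<open>C1_rect l T x\<close> _ _ l t\<^sub>0 z _ entry xl])
      show "continuous_on ({0..l} \<times> {0..T}) (\<lambda>(z, t). a)"
        by (simp add: case_prod_unfold)
      show "partial_t T x y s - c * partial_z l x y s = a * x y s"
        if "y \<in> {0..l}" "s \<in> {0..T}" "y + c * s = l + c * t\<^sub>0" for y s
        using eq[OF that(1,2)] xs_zero[OF that] \<psi>0[OF that(1,2)] by (simp add: us)
      show "T \<in> {0..T}"
        using \<open>0 < T\<close> by simp
    qed
  qed
  have "integral {0..l} (\<lambda>z. g z 0 * (\<phi> z)\<^sup>2) = integral {0..l} (\<lambda>z. \<phi> z * (g z 0 * \<phi> z + \<psi> z 0))"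
    using \<open>0 < T\<close> by (intro integral_cong) (simp add: \<psi>0 power2_eq_square)
  then show ?thesis
    unfolding optimal_pair_def using adm lower cost_us final by metis
qed

end
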